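(* Let $k=\mathbb C$ and let $\mathcal D_H$ be a left $H$-category. Let $\mathbb G(\mathcal D_H)=\prod_{X\in Ob(\mathcal D_H)}Aut_{\mathcal D_H}(X)$ and let $\mathbb U_H(\mathcal D_H)$ be the set of all $\eta=\{\eta(X)\}_{X}\in\mathbb G(\mathcal D_H)$ such that $h(\eta(X))=\varepsilon(h)\eta(X)$ for every $h\in H$ and $X\in Ob(\mathcal D_H)$. Then $\mathbb U_H(\mathcal D_H)$ is a subgroup of $\mathbb G(\mathcal D_H)$.
   Context: $H$ is a Hopf algebra over $k=\mathbb C$ with coproduct $\Delta(h)=h_1\otimes h_2$, counit $\varepsilon$ and bijective antipode. A left $H$-category is a small $k$-linear category $\mathcal D_H$ such that each $Hom_{\mathcal D_H}(X,Y)$ is a left $H$-module, $h(id_X)=\varepsilon(h)id_X$, and $h(gf)=(h_1g)(h_2f)$ for all $h\in H$ and composable $f,g$. The group structure on $\mathbb G(\mathcal D_H)$ is objectwise composition. *)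

theory Defs
  imports Complex_Main "HOL-Algebra.Module" "HOL-Algebra.Product_Groups" "HOL-Library.Poly_Mapping"
begin

section \<open>Complex vector spaces and algebras\<close>

class complex_vector = ab_group_add +
  fixes scaleC :: "complex \<Rightarrow> 'a \<Rightarrow> 'a"  (infixr \<open>*\<^sub>C\<close> 75)
  assumes scaleC_add_right: "a *\<^sub>C (x + y) = a *\<^sub>C x + a *\<^sub>C y"
    and scaleC_add_left: "(a + b) *\<^sub>C x = a *\<^sub>C x + b *\<^sub>C x"
    and scaleC_scaleC: "a *\<^sub>C (b *\<^sub>C x) = (a * b) *\<^sub>C x"
    and scaleC_one: "1 *\<^sub>C x = x"

text \<open>Associative unital algebras. The condition \<open>0 \<noteq> 1\<close> contained in the class \<open>ring_1\<close> is harmless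
  for Hopf algebras, because the counit maps 1 to 1 and 0 to 0.\<close>

class complex_algebra_1 = complex_vector + ring_1 +
  assumes mult_scaleC_left: "(a *\<^sub>C x) * y = a *\<^sub>C (x * y)"
    and mult_scaleC_right: "x * (a *\<^sub>C y) = a *\<^sub>C (x * y)"

global_interpretation complex_vector: vector_space "scaleC :: complex \<Rightarrow> 'a \<Rightarrow> 'a::complex_vector"
  by unfold_locales (simp_all add: scaleC_add_right scaleC_add_left scaleC_scaleC scaleC_one)

abbreviation clinear :: "('a::complex_vector \<Rightarrow> 'b::complex_vector) \<Rightarrow> bool" where
  "clinear \<equiv> Vector_Spaces.linear scaleC scaleC"

definition cbilinear :: "('a::complex_vector \<Rightarrow> 'b::complex_vector \<Rightarrow> 'c::complex_vector) \<Rightarrow> bool" where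
  "cbilinear f \<longleftrightarrow> (\<forall>x. clinear (f x)) \<and> (\<forall>y. clinear (\<lambda>x. f x y))"

lemma clinearI:
  assumes "\<And>x y. f (x + y) = f x + f y" "\<And>c x. f (c *\<^sub>C x) = c *\<^sub>C f x"
  shows "clinear f"
  using assms by unfold_locales auto

lemma clinear_add: "clinear f \<Longrightarrow> f (x + y) = f x + f y"
  and clinear_scale: "clinear f \<Longrightarrow> f (c *\<^sub>C x) = c *\<^sub>C f x"
  by (simp_all add: Vector_Spaces.linear.axioms(3) module_hom.add module_hom.scale
      flip: module_hom_iff_linear)

instantiation complex :: complex_vector
begin
definition scaleC_complex :: "complex \<Rightarrow> complex \<Rightarrow> complex" where "scaleC_complex = (*)"
instance by standard (simp_all add: scaleC_complex_def algebra_simps)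
end

instantiation poly_mapping :: (type, complex_vector) complex_vector
begin
definition scaleC_poly_mapping :: "complex \<Rightarrow> ('a \<Rightarrow>\<^sub>0 'b) \<Rightarrow> ('a \<Rightarrow>\<^sub>0 'b)" where
  "scaleC_poly_mapping c = Poly_Mapping.map (scaleC c)"
lemma lookup_scaleC: "poly_mapping.lookup (c *\<^sub>C p) k = c *\<^sub>C poly_mapping.lookup p k"
  for p :: "'a \<Rightarrow>\<^sub>0 'b"
  by (simp add: scaleC_poly_mapping_def Poly_Mapping.map.rep_eq when_def)
instance
  by (standard; rule poly_mapping_eqI)
    (simp_all add: lookup_scaleC lookup_add scaleC_add_right scaleC_add_left scaleC_scaleC scaleC_one)
end

section \<open>The tensor product of two complex vector spaces\<close>

text \<open>The free vector space on \<open>V \<times> W\<close> modulo the span of the bilinearity relations.\<close>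

definition tensor_relators :: "('a::complex_vector \<times> 'b::complex_vector \<Rightarrow>\<^sub>0 complex) set" where
  "tensor_relators =
     {Poly_Mapping.single (x + y, z) 1 - Poly_Mapping.single (x, z) 1 - Poly_Mapping.single (y, z) 1 | x y z. True} \<union>
     {Poly_Mapping.single (x, z + w) 1 - Poly_Mapping.single (x, z) 1 - Poly_Mapping.single (x, w) 1 | x z w. True} \<union>
     {Poly_Mapping.single (c *\<^sub>C x, z) 1 - c *\<^sub>C Poly_Mapping.single (x, z) 1 | c x z. True} \<union>
     {Poly_Mapping.single (x, c *\<^sub>C z) 1 - c *\<^sub>C Poly_Mapping.single (x, z) 1 | c x z. True}"

definition tensor_eq ::
  "('a::complex_vector \<times> 'b::complex_vector \<Rightarrow>\<^sub>0 complex) \<Rightarrow> ('a \<times> 'b \<Rightarrow>\<^sub>0 complex) \<Rightarrow> bool" where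
  "tensor_eq p q \<longleftrightarrow> p - q \<in> complex_vector.span tensor_relators"

lemma equivp_tensor_eq:
  "equivp (tensor_eq :: ('a::complex_vector \<times> 'b::complex_vector \<Rightarrow>\<^sub>0 complex) \<Rightarrow> _)"
proof (rule equivpI)
  show "reflp (tensor_eq :: ('a \<times> 'b \<Rightarrow>\<^sub>0 complex) \<Rightarrow> _)"
    by (simp add: reflp_def tensor_eq_def complex_vector.span_zero)
  show "symp (tensor_eq :: ('a \<times> 'b \<Rightarrow>\<^sub>0 complex) \<Rightarrow> _)"
    unfolding symp_def tensor_eq_def by (metis complex_vector.span_neg minus_diff_eq)
  show "transp (tensor_eq :: ('a \<times> 'b \<Rightarrow>\<^sub>0 complex) \<Rightarrow> _)"
  proof (rule transpI)
    fix p q r :: "'a \<times> 'b \<Rightarrow>\<^sub>0 complex"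
    assume "tensor_eq p q" "tensor_eq q r"
    then have "(p - q) + (q - r) \<in> complex_vector.span tensor_relators"
      unfolding tensor_eq_def by (rule complex_vector.span_add)
    then show "tensor_eq p r" by (simp add: tensor_eq_def)
  qed
qed

quotient_type (overloaded) ('a, 'b) tensor =
  "'a::complex_vector \<times> 'b::complex_vector \<Rightarrow>\<^sub>0 complex" / tensor_eq
  by (rule equivp_tensor_eq)

instantiation tensor :: (complex_vector, complex_vector) complex_vector
begin
lift_definition zero_tensor :: "('a, 'b) tensor" is 0 .
lift_definition plus_tensor :: "('a, 'b) tensor \<Rightarrow> ('a, 'b) tensor \<Rightarrow> ('a, 'b) tensor" is "(+)"
  unfolding tensor_eq_def add_diff_add by (rule complex_vector.span_add)
lift_definition uminus_tensor :: "('a, 'b) tensor \<Rightarrow> ('a, 'b) tensor" is uminus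
  unfolding tensor_eq_def minus_diff_minus by (rule complex_vector.span_neg)
lift_definition minus_tensor :: "('a, 'b) tensor \<Rightarrow> ('a, 'b) tensor \<Rightarrow> ('a, 'b) tensor" is "(-)"
proof -
  fix p p' q q' :: "'a \<times> 'b \<Rightarrow>\<^sub>0 complex"
  assume "tensor_eq p p'" "tensor_eq q q'"
  then have "(p - p') - (q - q') \<in> complex_vector.span tensor_relators"
    unfolding tensor_eq_def by (rule complex_vector.span_diff)
  then show "tensor_eq (p - q) (p' - q')" by (simp add: tensor_eq_def algebra_simps)
qed
lift_definition scaleC_tensor :: "complex \<Rightarrow> ('a, 'b) tensor \<Rightarrow> ('a, 'b) tensor" is scaleC
  unfolding tensor_eq_def complex_vector.scale_right_diff_distrib[symmetric]
  by (rule complex_vector.span_scale)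
instance
proof
  fix x y z :: "('a, 'b) tensor" and a b :: complex
  show "x + y + z = x + (y + z)" by transfer (simp add: equivp_reflp[OF equivp_tensor_eq] add.assoc)
  show "x + y = y + x" by transfer (simp add: equivp_reflp[OF equivp_tensor_eq] add.commute)
  show "0 + x = x" by transfer (simp add: equivp_reflp[OF equivp_tensor_eq])
  show "- x + x = 0" by transfer (simp add: equivp_reflp[OF equivp_tensor_eq])
  show "x - y = x + - y" by transfer (simp add: equivp_reflp[OF equivp_tensor_eq])
  show "a *\<^sub>C (x + y) = a *\<^sub>C x + a *\<^sub>C y"
    by transfer (simp add: equivp_reflp[OF equivp_tensor_eq] scaleC_add_right)
  show "(a + b) *\<^sub>C x = a *\<^sub>C x + b *\<^sub>C x"
    by transfer (simp add: equivp_reflp[OF equivp_tensor_eq] scaleC_add_left)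
  show "a *\<^sub>C (b *\<^sub>C x) = (a * b) *\<^sub>C x"
    by transfer (simp add: equivp_reflp[OF equivp_tensor_eq] scaleC_scaleC)
  show "1 *\<^sub>C x = x"
    by transfer (simp add: equivp_reflp[OF equivp_tensor_eq] scaleC_one)
qed
end

lift_definition pure_tensor :: "'a::complex_vector \<Rightarrow> 'b::complex_vector \<Rightarrow> ('a, 'b) tensor"
  (infixl \<open>\<otimes>\<^sub>\<complex>\<close> 76) is "\<lambda>x y. Poly_Mapping.single (x, y) 1" .

text \<open>The linear map induced by a bilinear map; see \<open>tensor_universal\<close> below.\<close>

definition tensor_lift ::
  "('a::complex_vector \<Rightarrow> 'b::complex_vector \<Rightarrow> 'c::complex_vector) \<Rightarrow> ('a, 'b) tensor \<Rightarrow> 'c" where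
  "tensor_lift f = (THE \<phi>. clinear \<phi> \<and> (\<forall>x y. \<phi> (x \<otimes>\<^sub>\<complex> y) = f x y))"

definition tensor_map ::
  "('a::complex_vector \<Rightarrow> 'c::complex_vector) \<Rightarrow> ('b::complex_vector \<Rightarrow> 'd::complex_vector) \<Rightarrow>
   ('a, 'b) tensor \<Rightarrow> ('c, 'd) tensor" where
  "tensor_map f g = tensor_lift (\<lambda>x y. f x \<otimes>\<^sub>\<complex> g y)"

definition tensor_assoc ::
  "(('a::complex_vector, 'b::complex_vector) tensor, 'c::complex_vector) tensor \<Rightarrow>
   ('a, ('b, 'c) tensor) tensor" where
  "tensor_assoc = tensor_lift (\<lambda>t z. tensor_lift (\<lambda>x y. x \<otimes>\<^sub>\<complex> (y \<otimes>\<^sub>\<complex> z)) t)"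

definition tensor_mult ::
  "('a::complex_algebra_1, 'b::complex_algebra_1) tensor \<Rightarrow> ('a, 'b) tensor \<Rightarrow> ('a, 'b) tensor" where
  "tensor_mult s t =
     tensor_lift (\<lambda>a b. tensor_lift (\<lambda>c d. (a * c) \<otimes>\<^sub>\<complex> (b * d)) t) s"

lemma tensor_relatorsI:
  "Poly_Mapping.single (x + y, z) 1 - Poly_Mapping.single (x, z) 1 - Poly_Mapping.single (y, z) 1
     \<in> tensor_relators"
  "Poly_Mapping.single (x, z + w) 1 - Poly_Mapping.single (x, z) 1 - Poly_Mapping.single (x, w) 1
     \<in> tensor_relators"
  "Poly_Mapping.single (c *\<^sub>C x, z) 1 - c *\<^sub>C Poly_Mapping.single (x, z) 1 \<in> tensor_relators"
  "Poly_Mapping.single (x, c *\<^sub>C z) 1 - c *\<^sub>C Poly_Mapping.single (x, z) 1 \<in> tensor_relators"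
  unfolding tensor_relators_def by blast+

lemma pure_tensor_add_left: "(x + y) \<otimes>\<^sub>\<complex> z = x \<otimes>\<^sub>\<complex> z + y \<otimes>\<^sub>\<complex> z"
  by transfer (simp only: tensor_eq_def diff_diff_add[symmetric]
      complex_vector.span_base tensor_relatorsI)

lemma pure_tensor_add_right: "x \<otimes>\<^sub>\<complex> (z + w) = x \<otimes>\<^sub>\<complex> z + x \<otimes>\<^sub>\<complex> w"
  by transfer (simp only: tensor_eq_def diff_diff_add[symmetric]
      complex_vector.span_base tensor_relatorsI)

lemma pure_tensor_scale_left: "(c *\<^sub>C x) \<otimes>\<^sub>\<complex> z = c *\<^sub>C (x \<otimes>\<^sub>\<complex> z)"
  by transfer (simp only: tensor_eq_def complex_vector.span_base tensor_relatorsI)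

lemma pure_tensor_scale_right: "x \<otimes>\<^sub>\<complex> (c *\<^sub>C z) = c *\<^sub>C (x \<otimes>\<^sub>\<complex> z)"
  by transfer (simp only: tensor_eq_def complex_vector.span_base tensor_relatorsI)

lemma poly_mapping_expand:
  fixes p :: "'a \<Rightarrow>\<^sub>0 complex"
  shows "p = (\<Sum>k\<in>Poly_Mapping.keys p. poly_mapping.lookup p k *\<^sub>C Poly_Mapping.single k 1)"
proof (rule poly_mapping_eqI)
  fix j
  have "poly_mapping.lookup (\<Sum>k\<in>Poly_Mapping.keys p. poly_mapping.lookup p k *\<^sub>C Poly_Mapping.single k 1) j =
      (\<Sum>k\<in>Poly_Mapping.keys p. if k = j then poly_mapping.lookup p k else 0)"
    unfolding lookup_sum
    by (intro sum.cong refl) (simp add: lookup_scaleC lookup_single when_def scaleC_complex_def)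
  also have "\<dots> = poly_mapping.lookup p j"
    by (simp add: in_keys_iff)
  finally show "poly_mapping.lookup p j = poly_mapping.lookup (\<Sum>k\<in>Poly_Mapping.keys p. poly_mapping.lookup p k *\<^sub>C Poly_Mapping.single k 1) j" ..
qed

lemma abs_tensor_sum: "abs_tensor (\<Sum>k\<in>A. f k) = (\<Sum>k\<in>A. abs_tensor (f k))"
  by (induction A rule: infinite_finite_induct)
    (simp_all add: zero_tensor.abs_eq plus_tensor.abs_eq[symmetric])

lemma abs_tensor_expand:
  fixes p :: "'a::complex_vector \<times> 'b::complex_vector \<Rightarrow>\<^sub>0 complex"
  shows "abs_tensor p = (\<Sum>k\<in>Poly_Mapping.keys p. (poly_mapping.lookup p k *\<^sub>C fst k) \<otimes>\<^sub>\<complex> snd k)"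
proof -
  have "abs_tensor p = (\<Sum>k\<in>Poly_Mapping.keys p. abs_tensor (poly_mapping.lookup p k *\<^sub>C Poly_Mapping.single k 1))"
    by (subst poly_mapping_expand) (rule abs_tensor_sum)
  moreover have "abs_tensor (Poly_Mapping.single k 1) = fst k \<otimes>\<^sub>\<complex> snd k" for k :: "'a \<times> 'b"
    by (simp add: pure_tensor.abs_eq)
  ultimately show ?thesis
    by (simp add: scaleC_tensor.abs_eq[symmetric] pure_tensor_scale_left)
qed

lemma tensor_exists_abs: "\<exists>p. t = abs_tensor p"
  by (metis Quotient3_abs_rep Quotient3_tensor)

lemma tensor_sum_of_pure:
  "\<exists>(n::nat) x y. t = (\<Sum>i<n. x i \<otimes>\<^sub>\<complex> y i)"
proof -
  obtain p where p: "t = abs_tensor p"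
    using tensor_exists_abs by blast
  obtain e where e: "bij_betw e {..<card (Poly_Mapping.keys p)} (Poly_Mapping.keys p)"
    using ex_bij_betw_nat_finite[OF finite_keys[of p]] by (auto simp: atLeast0LessThan)
  have "t = (\<Sum>i<card (Poly_Mapping.keys p).
      (poly_mapping.lookup p (e i) *\<^sub>C fst (e i)) \<otimes>\<^sub>\<complex> snd (e i))"
    unfolding p abs_tensor_expand by (rule sum.reindex_bij_betw[OF e, symmetric])
  then show ?thesis
    by (intro exI[of _ "card (Poly_Mapping.keys p)"]
        exI[of _ "\<lambda>i. poly_mapping.lookup p (e i) *\<^sub>C fst (e i)"] exI[of _ "\<lambda>i. snd (e i)"])
qed

theorem tensor_universal:
  fixes f :: "'a::complex_vector \<Rightarrow> 'b::complex_vector \<Rightarrow> 'c::complex_vector"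
  assumes "cbilinear f"
  shows "\<exists>!\<phi>. clinear \<phi> \<and> (\<forall>x y. \<phi> (x \<otimes>\<^sub>\<complex> y) = f x y)"
proof -
  define F where "F p = (\<Sum>k\<in>Poly_Mapping.keys p. poly_mapping.lookup p k *\<^sub>C f (fst k) (snd k))" for p
  have F_sup: "F p = (\<Sum>k\<in>A. poly_mapping.lookup p k *\<^sub>C f (fst k) (snd k))"
    if "finite A" "Poly_Mapping.keys p \<subseteq> A" for p A
    unfolding F_def using that
    by (intro sum.mono_neutral_left) (auto simp: in_keys_iff)
  have F_lin: "clinear F"
  proof (rule clinearI)
    fix p q :: "'a \<times> 'b \<Rightarrow>\<^sub>0 complex"
    have "Poly_Mapping.keys (p + q) \<subseteq> Poly_Mapping.keys p \<union> Poly_Mapping.keys q" by (rule keys_add)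
    then show "F (p + q) = F p + F q"
      by (simp add: F_sup[of "Poly_Mapping.keys p \<union> Poly_Mapping.keys q"] lookup_add scaleC_add_left sum.distrib)
  next
    fix c and p :: "'a \<times> 'b \<Rightarrow>\<^sub>0 complex"
    have "Poly_Mapping.keys (c *\<^sub>C p) \<subseteq> Poly_Mapping.keys p"
      by (auto simp: in_keys_iff lookup_scaleC)
    then show "F (c *\<^sub>C p) = c *\<^sub>C F p"
      by (simp add: F_sup[of "Poly_Mapping.keys p"] lookup_scaleC scaleC_complex_def
          complex_vector.scale_sum_right)
  qed
  have F_single: "F (Poly_Mapping.single (x, y) 1) = f x y" for x y
    by (simp add: F_def)
  note F_diff = module_hom.diff[OF F_lin[unfolded module_hom_iff_linear[symmetric]]]
  have f_lin: "clinear (f x)" "clinear (\<lambda>x. f x y)" for x y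
    using assms by (auto simp: cbilinear_def)
  have "F r = 0" if "r \<in> tensor_relators" for r
    using that unfolding tensor_relators_def
    by (auto simp: F_diff clinear_scale[OF F_lin] F_single
        clinear_add[OF f_lin(1)] clinear_add[OF f_lin(2)]
        clinear_scale[OF f_lin(1)] clinear_scale[OF f_lin(2)])
  then have F_span: "F r = 0" if "r \<in> complex_vector.span tensor_relators" for r
    by (rule module_hom.eq_0_on_span[OF F_lin[unfolded module_hom_iff_linear[symmetric]] _ that])
  have F_cong: "F p = F q" if "tensor_eq p q" for p q
    using F_span[of "p - q"] that by (simp add: tensor_eq_def F_diff)
  define \<phi> where "\<phi> t = F (rep_tensor t)" for t
  have \<phi>_abs: "\<phi> (abs_tensor p) = F p" for p
    unfolding \<phi>_def
    by (intro F_cong Quotient3_rep_abs[OF Quotient3_tensor] equivp_reflp[OF equivp_tensor_eq])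
  have "clinear \<phi>"
  proof (rule clinearI)
    fix s t :: "('a, 'b) tensor"
    obtain p q where "s = abs_tensor p" "t = abs_tensor q"
      using tensor_exists_abs[of s] tensor_exists_abs[of t] by blast
    then show "\<phi> (s + t) = \<phi> s + \<phi> t"
      by (simp add: plus_tensor.abs_eq \<phi>_abs clinear_add[OF F_lin])
  next
    fix c and t :: "('a, 'b) tensor"
    obtain p where "t = abs_tensor p"
      using tensor_exists_abs[of t] by blast
    then show "\<phi> (c *\<^sub>C t) = c *\<^sub>C \<phi> t"
      by (simp add: scaleC_tensor.abs_eq \<phi>_abs clinear_scale[OF F_lin])
  qed
  moreover have "\<phi> (x \<otimes>\<^sub>\<complex> y) = f x y" for x y
    by (simp add: pure_tensor.abs_eq \<phi>_abs F_single)
  moreover have "\<psi> = \<phi>" if \<psi>: "clinear \<psi>" "\<And>x y. \<psi> (x \<otimes>\<^sub>\<complex> y) = f x y" for \<psi>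
  proof
    fix t :: "('a, 'b) tensor"
    obtain n :: nat and x y where t: "t = (\<Sum>i<n. x i \<otimes>\<^sub>\<complex> y i)"
      using tensor_sum_of_pure[of t] by blast
    show "\<psi> t = \<phi> t"
      unfolding t
      by (simp add: module_hom.sum[OF \<psi>(1)[unfolded module_hom_iff_linear[symmetric]]]
          module_hom.sum[OF \<open>clinear \<phi>\<close>[unfolded module_hom_iff_linear[symmetric]]]
          \<psi>(2) \<open>\<And>x y. \<phi> (x \<otimes>\<^sub>\<complex> y) = f x y\<close>)
  qed
  ultimately show ?thesis by blast
qed

lemma tensor_lift:
  assumes "cbilinear f"
  shows "clinear (tensor_lift f)" and "tensor_lift f (x \<otimes>\<^sub>\<complex> y) = f x y"
  using theI'[OF tensor_universal[OF assms]] unfolding tensor_lift_def by auto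

lemma clinear_sum: "clinear f \<Longrightarrow> f (\<Sum>i\<in>A. g i) = (\<Sum>i\<in>A. f (g i))"
  by (metis module_hom.sum module_hom_iff_linear)

lemma cbilinearI:
  assumes "\<And>x y z. f x (y + z) = f x y + f x z" "\<And>c x y. f x (c *\<^sub>C y) = c *\<^sub>C f x y"
    and "\<And>x y z. f (x + y) z = f x z + f y z" "\<And>c x y. f (c *\<^sub>C x) y = c *\<^sub>C f x y"
  shows "cbilinear f"
  using assms unfolding cbilinear_def by (auto intro!: clinearI)

lemma cbilinear_tensor_lift:
  fixes F :: "'a::complex_vector \<Rightarrow> 'b::complex_vector \<Rightarrow> 'c::complex_vector \<Rightarrow> 'd::complex_vector"
  assumes "\<And>z. cbilinear (\<lambda>x y. F x y z)" "\<And>x y. clinear (F x y)"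
  shows "cbilinear (\<lambda>t z. tensor_lift (\<lambda>x y. F x y z) t)"
proof (rule cbilinearI)
  note L = tensor_lift[OF assms(1)]
  fix t :: "('a, 'b) tensor" and z w :: 'c and c
  obtain n :: nat and x y where t: "t = (\<Sum>i<n. x i \<otimes>\<^sub>\<complex> y i)"
    using tensor_sum_of_pure[of t] by blast
  show "tensor_lift (\<lambda>x y. F x y (z + w)) t =
      tensor_lift (\<lambda>x y. F x y z) t + tensor_lift (\<lambda>x y. F x y w) t"
    unfolding t clinear_sum[OF L(1)] L(2) by (simp add: clinear_add[OF assms(2)] sum.distrib)
  show "tensor_lift (\<lambda>x y. F x y (c *\<^sub>C z)) t = c *\<^sub>C tensor_lift (\<lambda>x y. F x y z) t"
    unfolding t clinear_sum[OF L(1)] L(2)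
    by (simp add: clinear_scale[OF assms(2)] complex_vector.scale_sum_right)
qed (simp_all add: clinear_add clinear_scale tensor_lift(1)[OF assms(1)])

lemma tensor_map_pure:
  assumes "clinear f" "clinear g"
  shows "clinear (tensor_map f g)" and "tensor_map f g (x \<otimes>\<^sub>\<complex> y) = f x \<otimes>\<^sub>\<complex> g y"
proof -
  have "cbilinear (\<lambda>x y. f x \<otimes>\<^sub>\<complex> g y)"
    by (rule cbilinearI) (simp_all add: assms clinear_add clinear_scale pure_tensor_add_left
        pure_tensor_add_right pure_tensor_scale_left pure_tensor_scale_right)
  from tensor_lift[OF this]
  show "clinear (tensor_map f g)" and "tensor_map f g (x \<otimes>\<^sub>\<complex> y) = f x \<otimes>\<^sub>\<complex> g y"
    by (simp_all add: tensor_map_def)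
qed

lemma tensor_assoc_pure:
  fixes x :: "'a::complex_vector" and y :: "'b::complex_vector" and z :: "'c::complex_vector"
  shows "clinear (tensor_assoc :: (('a, 'b) tensor, 'c) tensor \<Rightarrow> _)"
    and "tensor_assoc ((x \<otimes>\<^sub>\<complex> y) \<otimes>\<^sub>\<complex> z) = x \<otimes>\<^sub>\<complex> (y \<otimes>\<^sub>\<complex> z)"
proof -
  have inner: "cbilinear (\<lambda>(x::'a) (y::'b). x \<otimes>\<^sub>\<complex> (y \<otimes>\<^sub>\<complex> z))" for z :: 'c
    by (rule cbilinearI) (simp_all add: pure_tensor_add_left
        pure_tensor_add_right pure_tensor_scale_left pure_tensor_scale_right)
  have "cbilinear (\<lambda>t (z::'c). tensor_lift (\<lambda>(x::'a) (y::'b). x \<otimes>\<^sub>\<complex> (y \<otimes>\<^sub>\<complex> z)) t)"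
    by (rule cbilinear_tensor_lift, rule inner) (rule clinearI, simp_all add:
        pure_tensor_add_right pure_tensor_scale_right)
  from tensor_lift[OF this] show "clinear (tensor_assoc :: (('a, 'b) tensor, 'c) tensor \<Rightarrow> _)"
    and "tensor_assoc ((x \<otimes>\<^sub>\<complex> y) \<otimes>\<^sub>\<complex> z) = x \<otimes>\<^sub>\<complex> (y \<otimes>\<^sub>\<complex> z)"
    unfolding tensor_assoc_def by (simp_all add: tensor_lift(2)[OF inner])
qed

lemma tensor_mult_pure:
  fixes a c :: "'a::complex_algebra_1" and b d :: "'b::complex_algebra_1"
  shows "cbilinear (tensor_mult :: ('a, 'b) tensor \<Rightarrow> _)"
    and "tensor_mult (a \<otimes>\<^sub>\<complex> b) (c \<otimes>\<^sub>\<complex> d) = (a * c) \<otimes>\<^sub>\<complex> (b * d)"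
proof -
  let ?F = "\<lambda>t (a::'a) (b::'b). tensor_lift (\<lambda>c d. (a * c) \<otimes>\<^sub>\<complex> (b * d)) t"
  note simps = distrib_left distrib_right mult_scaleC_left mult_scaleC_right
    pure_tensor_add_left pure_tensor_add_right pure_tensor_scale_left pure_tensor_scale_right
  have inner: "cbilinear (\<lambda>c d. (a * c) \<otimes>\<^sub>\<complex> (b * d))" for a :: 'a and b :: 'b
    by (rule cbilinearI) (simp_all add: simps)
  note L = tensor_lift[OF inner]
  have outer: "cbilinear (?F t)" for t
  proof -
    obtain n :: nat and x y where t: "t = (\<Sum>i<n. x i \<otimes>\<^sub>\<complex> y i)"
      using tensor_sum_of_pure[of t] by blast
    show ?thesis
      unfolding t clinear_sum[OF L(1)] L(2)
      by (rule cbilinearI) (simp_all add: simps sum.distrib complex_vector.scale_sum_right)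
  qed
  have "cbilinear (\<lambda>s t. tensor_lift (\<lambda>a b. ?F t a b) s)"
    by (rule cbilinear_tensor_lift, rule outer) (rule L(1))
  then show "cbilinear (tensor_mult :: ('a, 'b) tensor \<Rightarrow> _)"
    by (simp add: tensor_mult_def[abs_def])
  show "tensor_mult (a \<otimes>\<^sub>\<complex> b) (c \<otimes>\<^sub>\<complex> d) = (a * c) \<otimes>\<^sub>\<complex> (b * d)"
    unfolding tensor_mult_def by (rule trans[OF tensor_lift(2)[OF outer] L(2)])
qed

section \<open>Hopf algebras\<close>

locale hopf_algebra =
  fixes \<Delta> :: "'h::complex_algebra_1 \<Rightarrow> ('h, 'h) tensor"
    and \<epsilon> :: "'h \<Rightarrow> complex"
    and S :: "'h \<Rightarrow> 'h"
  assumes coproduct_linear: "clinear \<Delta>"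
    and counit_linear: "clinear \<epsilon>"
    and antipode_linear: "clinear S"
    and coassoc: "tensor_assoc (tensor_map \<Delta> id (\<Delta> h)) = tensor_map id \<Delta> (\<Delta> h)"
    and counit_left: "tensor_lift (\<lambda>a b. \<epsilon> a *\<^sub>C b) (\<Delta> h) = h"
    and counit_right: "tensor_lift (\<lambda>a b. \<epsilon> b *\<^sub>C a) (\<Delta> h) = h"
    and coproduct_mult: "\<Delta> (g * h) = tensor_mult (\<Delta> g) (\<Delta> h)"
    and coproduct_one: "\<Delta> 1 = 1 \<otimes>\<^sub>\<complex> 1"
    and counit_mult: "\<epsilon> (g * h) = \<epsilon> g * \<epsilon> h"
    and counit_one: "\<epsilon> 1 = 1"
    and antipode_left: "tensor_lift (\<lambda>a b. S a * b) (\<Delta> h) = \<epsilon> h *\<^sub>C 1"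
    and antipode_right: "tensor_lift (\<lambda>a b. a * S b) (\<Delta> h) = \<epsilon> h *\<^sub>C 1"

section \<open>Linear categories and left \<open>H\<close>-categories\<close>

definition complex_ring :: "complex ring" where
  "complex_ring = \<lparr>carrier = UNIV, monoid.mult = (*), one = 1, zero = 0, add = (+)\<rparr>"

text \<open>Only the additive and scalar parts of the module record \<open>Hom D X Y\<close> are used; the fields
  \<open>mult\<close> and \<open>one\<close>, which that record inherits from the type of rings, play no role.
  \<open>Comp D X Y Z g f\<close> is the composite of \<open>f \<in> Hom(X, Y)\<close> and \<open>g \<in> Hom(Y, Z)\<close>.\<close>

record ('o, 'm) linear_cat =
  Ob :: "'o set"
  Hom :: "'o \<Rightarrow> 'o \<Rightarrow> (complex, 'm) module"
  Comp :: "'o \<Rightarrow> 'o \<Rightarrow> 'o \<Rightarrow> 'm \<Rightarrow> 'm \<Rightarrow> 'm"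
  Ident :: "'o \<Rightarrow> 'm"

record ('o, 'm, 'h) H_cat = "('o, 'm) linear_cat" +
  Act :: "'o \<Rightarrow> 'o \<Rightarrow> 'h \<Rightarrow> 'm \<Rightarrow> 'm"

locale linear_category =
  fixes D :: "('o, 'm, 'x) linear_cat_scheme"
  assumes Hom_module:
      "\<lbrakk>X \<in> Ob D; Y \<in> Ob D\<rbrakk> \<Longrightarrow> Module.module complex_ring (Hom D X Y)"
    and Ident_closed: "X \<in> Ob D \<Longrightarrow> Ident D X \<in> carrier (Hom D X X)"
    and Comp_closed:
      "\<lbrakk>X \<in> Ob D; Y \<in> Ob D; Z \<in> Ob D; f \<in> carrier (Hom D X Y); g \<in> carrier (Hom D Y Z)\<rbrakk>
       \<Longrightarrow> Comp D X Y Z g f \<in> carrier (Hom D X Z)"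
    and Comp_Ident_left:
      "\<lbrakk>X \<in> Ob D; Y \<in> Ob D; f \<in> carrier (Hom D X Y)\<rbrakk> \<Longrightarrow> Comp D X Y Y (Ident D Y) f = f"
    and Comp_Ident_right:
      "\<lbrakk>X \<in> Ob D; Y \<in> Ob D; f \<in> carrier (Hom D X Y)\<rbrakk> \<Longrightarrow> Comp D X X Y f (Ident D X) = f"
    and Comp_assoc:
      "\<lbrakk>W \<in> Ob D; X \<in> Ob D; Y \<in> Ob D; Z \<in> Ob D;
        f \<in> carrier (Hom D W X); g \<in> carrier (Hom D X Y); k \<in> carrier (Hom D Y Z)\<rbrakk>
       \<Longrightarrow> Comp D W X Z (Comp D X Y Z k g) f = Comp D W Y Z k (Comp D W X Y g f)"
    and Comp_add_left:
      "\<lbrakk>X \<in> Ob D; Y \<in> Ob D; Z \<in> Ob D; f \<in> carrier (Hom D X Y);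
        g \<in> carrier (Hom D Y Z); g' \<in> carrier (Hom D Y Z)\<rbrakk>
       \<Longrightarrow> Comp D X Y Z (g \<oplus>\<^bsub>Hom D Y Z\<^esub> g') f
          = Comp D X Y Z g f \<oplus>\<^bsub>Hom D X Z\<^esub> Comp D X Y Z g' f"
    and Comp_add_right:
      "\<lbrakk>X \<in> Ob D; Y \<in> Ob D; Z \<in> Ob D; f \<in> carrier (Hom D X Y);
        f' \<in> carrier (Hom D X Y); g \<in> carrier (Hom D Y Z)\<rbrakk>
       \<Longrightarrow> Comp D X Y Z g (f \<oplus>\<^bsub>Hom D X Y\<^esub> f')
          = Comp D X Y Z g f \<oplus>\<^bsub>Hom D X Z\<^esub> Comp D X Y Z g f'"
    and Comp_smult_left:
      "\<lbrakk>X \<in> Ob D; Y \<in> Ob D; Z \<in> Ob D; f \<in> carrier (Hom D X Y); g \<in> carrier (Hom D Y Z)\<rbrakk>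
       \<Longrightarrow> Comp D X Y Z (c \<odot>\<^bsub>Hom D Y Z\<^esub> g) f = c \<odot>\<^bsub>Hom D X Z\<^esub> Comp D X Y Z g f"
    and Comp_smult_right:
      "\<lbrakk>X \<in> Ob D; Y \<in> Ob D; Z \<in> Ob D; f \<in> carrier (Hom D X Y); g \<in> carrier (Hom D Y Z)\<rbrakk>
       \<Longrightarrow> Comp D X Y Z g (c \<odot>\<^bsub>Hom D X Y\<^esub> f) = c \<odot>\<^bsub>Hom D X Z\<^esub> Comp D X Y Z g f"

text \<open>In \<open>Act_Comp\<close> the Sweedler sum is taken over an arbitrary representation of \<open>\<Delta> h\<close> as a finite
  sum of pure tensors. One exists by \<open>tensor_sum_of_pure\<close>, and the value does not depend on it since
  the action and the composition are bilinear.\<close>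

locale left_H_category = linear_category D
  for \<Delta> :: "'h::complex_algebra_1 \<Rightarrow> ('h, 'h) tensor"
    and \<epsilon> :: "'h \<Rightarrow> complex"
    and D :: "('o, 'm, 'h, 'x) H_cat_scheme" +
  assumes Act_closed:
      "\<lbrakk>X \<in> Ob D; Y \<in> Ob D; f \<in> carrier (Hom D X Y)\<rbrakk> \<Longrightarrow> Act D X Y h f \<in> carrier (Hom D X Y)"
    and Act_add_right:
      "\<lbrakk>X \<in> Ob D; Y \<in> Ob D; f \<in> carrier (Hom D X Y); f' \<in> carrier (Hom D X Y)\<rbrakk>
       \<Longrightarrow> Act D X Y h (f \<oplus>\<^bsub>Hom D X Y\<^esub> f') = Act D X Y h f \<oplus>\<^bsub>Hom D X Y\<^esub> Act D X Y h f'"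
    and Act_smult_right:
      "\<lbrakk>X \<in> Ob D; Y \<in> Ob D; f \<in> carrier (Hom D X Y)\<rbrakk>
       \<Longrightarrow> Act D X Y h (c \<odot>\<^bsub>Hom D X Y\<^esub> f) = c \<odot>\<^bsub>Hom D X Y\<^esub> Act D X Y h f"
    and Act_add_left:
      "\<lbrakk>X \<in> Ob D; Y \<in> Ob D; f \<in> carrier (Hom D X Y)\<rbrakk>
       \<Longrightarrow> Act D X Y (h + h') f = Act D X Y h f \<oplus>\<^bsub>Hom D X Y\<^esub> Act D X Y h' f"
    and Act_scale_left:
      "\<lbrakk>X \<in> Ob D; Y \<in> Ob D; f \<in> carrier (Hom D X Y)\<rbrakk>
       \<Longrightarrow> Act D X Y (c *\<^sub>C h) f = c \<odot>\<^bsub>Hom D X Y\<^esub> Act D X Y h f"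
    and Act_one:
      "\<lbrakk>X \<in> Ob D; Y \<in> Ob D; f \<in> carrier (Hom D X Y)\<rbrakk> \<Longrightarrow> Act D X Y 1 f = f"
    and Act_mult:
      "\<lbrakk>X \<in> Ob D; Y \<in> Ob D; f \<in> carrier (Hom D X Y)\<rbrakk>
       \<Longrightarrow> Act D X Y (h * h') f = Act D X Y h (Act D X Y h' f)"
    and Act_Ident:
      "X \<in> Ob D \<Longrightarrow> Act D X X h (Ident D X) = \<epsilon> h \<odot>\<^bsub>Hom D X X\<^esub> Ident D X"
    and Act_Comp:
      "\<lbrakk>X \<in> Ob D; Y \<in> Ob D; Z \<in> Ob D; f \<in> carrier (Hom D X Y); g \<in> carrier (Hom D Y Z);
        \<Delta> h = (\<Sum>i<(n::nat). h\<^sub>1 i \<otimes>\<^sub>\<complex> h\<^sub>2 i)\<rbrakk>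
       \<Longrightarrow> Act D X Z h (Comp D X Y Z g f)
          = (\<Oplus>\<^bsub>Hom D X Z\<^esub>i\<in>{..<n}. Comp D X Y Z (Act D Y Z (h\<^sub>1 i) g) (Act D X Y (h\<^sub>2 i) f))"

section \<open>The groups \<open>\<G>\<close> and \<open>\<U>\<^sub>H\<close>\<close>

definition End_monoid :: "('o, 'm, 'x) linear_cat_scheme \<Rightarrow> 'o \<Rightarrow> 'm monoid" where
  "End_monoid D X = \<lparr>carrier = carrier (Hom D X X), monoid.mult = Comp D X X X, one = Ident D X\<rparr>"

definition Aut_group :: "('o, 'm, 'x) linear_cat_scheme \<Rightarrow> 'o \<Rightarrow> 'm monoid" where
  "Aut_group D X = units_of (End_monoid D X)"

definition GG :: "('o, 'm, 'x) linear_cat_scheme \<Rightarrow> ('o \<Rightarrow> 'm) monoid" where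
  "GG D = product_group (Ob D) (Aut_group D)"

definition UU :: "('h \<Rightarrow> complex) \<Rightarrow> ('o, 'm, 'h, 'x) H_cat_scheme \<Rightarrow> ('o \<Rightarrow> 'm) set" where
  "UU \<epsilon> D = {\<eta> \<in> carrier (GG D).
     \<forall>h. \<forall>X\<in>Ob D. Act D X X h (\<eta> X) = \<epsilon> h \<odot>\<^bsub>Hom D X X\<^esub> \<eta> X}"

lemma (in linear_category) group_GG: "group (GG D)"
proof -
  have "monoid (End_monoid D X)" if "X \<in> Ob D" for X
    using that by unfold_locales
      (auto simp: End_monoid_def Comp_closed Ident_closed Comp_Ident_left Comp_Ident_right Comp_assoc)
  then show ?thesis
    unfolding GG_def Aut_group_def by (intro product_group monoid.units_group)
qed

end

theory Submission
  imports Defs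
begin

text \<open>An invariant \<open>g\<close> makes post-composition with \<open>g\<close> an \<open>H\<close>-linear map: by the counit axiom
  \<open>h (g f) = (h\<^sub>1 g) (h\<^sub>2 f) = \<epsilon>(h\<^sub>1) g (h\<^sub>2 f) = g (h f)\<close>. If \<open>f\<close> is invariant as well, then so is
  \<open>g f\<close>. If \<open>f\<close> is the inverse of \<open>g\<close>, then \<open>g (h f) = h(id) = \<epsilon>(h) id\<close>, and cancelling \<open>g\<close>
  gives \<open>h f = \<epsilon>(h) f\<close>.\<close>

text \<open>The lift of a bilinear map is linear and known on pure tensors, so the counit axiom can
  be read off any finite representation of \<open>\<Delta> h\<close>, the form in which
  \<open>Act_Comp\<close> supplies the Sweedler sum.\<close>

lemma (in hopf_algebra) counit_left_sum:
  assumes "\<Delta> h = (\<Sum>i<(n::nat). a i \<otimes>\<^sub>\<complex> b i)"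
  shows "(\<Sum>i<n. \<epsilon> (a i) *\<^sub>C b i) = h"
proof -
  have "cbilinear (\<lambda>a b. \<epsilon> a *\<^sub>C b)"
    by (rule cbilinearI)
      (simp_all add: clinear_add[OF counit_linear] clinear_scale[OF counit_linear]
        scaleC_add_left scaleC_add_right scaleC_scaleC scaleC_complex_def mult.commute)
  note L = tensor_lift[OF this]
  show ?thesis
    using counit_left[of h] by (simp add: assms clinear_sum[OF L(1)] L(2))
qed

context left_H_category
begin

definition invariant :: "'o \<Rightarrow> 'o \<Rightarrow> 'm \<Rightarrow> bool" where
  "invariant X Y f \<longleftrightarrow> (\<forall>h. Act D X Y h f = \<epsilon> h \<odot>\<^bsub>Hom D X Y\<^esub> f)"

text \<open>Linearity of \<open>h \<mapsto> g (h f)\<close>. It carries a sum formed in the module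
  \<open>Hom D X Z\<close> over to a sum in \<open>H\<close>, where the counit axiom can be
  applied.\<close>

lemma Comp_Act_sum:
  assumes "X \<in> Ob D" "Y \<in> Ob D" "Z \<in> Ob D" "f \<in> carrier (Hom D X Y)" "g \<in> carrier (Hom D Y Z)"
  shows "(\<Oplus>\<^bsub>Hom D X Z\<^esub>i\<in>{..<n::nat}. Comp D X Y Z g (Act D X Y (k i) f))
    = Comp D X Y Z g (Act D X Y (\<Sum>i<n. k i) f)"
proof -
  interpret M: Module.module complex_ring "Hom D X Z"
    using assms by (intro Hom_module)
  have closed: "Comp D X Y Z g (Act D X Y h f) \<in> carrier (Hom D X Z)" for h
    using assms by (intro Comp_closed Act_closed)
  show ?thesis
  proof (induction n)
    case 0
    \<comment> \<open>Writing the zero of \<open>H\<close> as a scalar multiple lets homogeneity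
      pull the scalar 0 out in front of the composite.\<close>
    have "Comp D X Y Z g (Act D X Y (0 *\<^sub>C 0) f) = 0 \<odot>\<^bsub>Hom D X Z\<^esub> Comp D X Y Z g (Act D X Y 0 f)"
      using assms by (simp only: Act_scale_left Comp_smult_right Act_closed)
    also have "\<dots> = \<zero>\<^bsub>Hom D X Z\<^esub>"
      using M.smult_l_null[OF closed] by (simp add: complex_ring_def)
    finally show ?case by simp
  next
    case (Suc n)
    have "(\<Oplus>\<^bsub>Hom D X Z\<^esub>i\<in>{..<Suc n}. Comp D X Y Z g (Act D X Y (k i) f))
        = Comp D X Y Z g (Act D X Y (k n) f) \<oplus>\<^bsub>Hom D X Z\<^esub>
          (\<Oplus>\<^bsub>Hom D X Z\<^esub>i\<in>{..<n}. Comp D X Y Z g (Act D X Y (k i) f))"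
      unfolding lessThan_Suc by (rule M.finsum_insert) (auto simp: closed)
    also have "\<dots> = Comp D X Y Z g (Act D X Y (k n + (\<Sum>i<n. k i)) f)"
      using assms by (simp only: Suc.IH Act_add_left Comp_add_right Act_closed)
    finally show ?case by (simp add: add.commute)
  qed
qed

lemma Act_Comp_invariant:
  assumes "hopf_algebra \<Delta> \<epsilon> S"
    and obs: "X \<in> Ob D" "Y \<in> Ob D" "Z \<in> Ob D"
    and f: "f \<in> carrier (Hom D X Y)" and g: "g \<in> carrier (Hom D Y Z)" "invariant Y Z g"
  shows "Act D X Z h (Comp D X Y Z g f) = Comp D X Y Z g (Act D X Y h f)"
proof -
  interpret hopf_algebra \<Delta> \<epsilon> S by fact
  interpret M: Module.module complex_ring "Hom D X Z"
    using obs by (intro Hom_module)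
  obtain n :: nat and a b where ab: "\<Delta> h = (\<Sum>i<n. a i \<otimes>\<^sub>\<complex> b i)"
    using tensor_sum_of_pure by blast
  \<comment> \<open>Invariance turns the action on \<open>g\<close> into the scalar
    \<open>\<epsilon> (a i)\<close>, which bilinearity moves onto the other tensor factor
    \<open>b i\<close>.\<close>
  have "Comp D X Y Z (Act D Y Z (a i) g) (Act D X Y (b i) f)
      = Comp D X Y Z g (Act D X Y (\<epsilon> (a i) *\<^sub>C b i) f)" for i
    using obs f g
    by (simp add: invariant_def Comp_smult_left Comp_smult_right Act_scale_left Act_closed)
  then have "Act D X Z h (Comp D X Y Z g f)
      = (\<Oplus>\<^bsub>Hom D X Z\<^esub>i\<in>{..<n}. Comp D X Y Z g (Act D X Y (\<epsilon> (a i) *\<^sub>C b i) f))"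
    by (simp add: Act_Comp[OF obs f g(1) ab])
  also have "\<dots> = Comp D X Y Z g (Act D X Y h f)"
    using obs f g(1) by (simp add: Comp_Act_sum counit_left_sum[OF ab])
  finally show ?thesis .
qed

lemma invariant_Ident: "X \<in> Ob D \<Longrightarrow> invariant X X (Ident D X)"
  by (simp add: invariant_def Act_Ident)

lemma invariant_Comp:
  assumes "hopf_algebra \<Delta> \<epsilon> S" "X \<in> Ob D" "Y \<in> Ob D" "Z \<in> Ob D"
    and "f \<in> carrier (Hom D X Y)" "invariant X Y f" "g \<in> carrier (Hom D Y Z)" "invariant Y Z g"
  shows "invariant X Z (Comp D X Y Z g f)"
  using assms
  \<comment> \<open>The invariance of \<open>g\<close> stays folded, since
    \<open>Act_Comp_invariant\<close> takes it as a premise; only that of \<open>f\<close> and of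
    the composite is unfolded.\<close>
  by (subst invariant_def) (simp add: Act_Comp_invariant invariant_def[of X Y] Comp_smult_right)

lemma invariant_inverse:
  assumes H: "hopf_algebra \<Delta> \<epsilon> S" and obs: "X \<in> Ob D" "Y \<in> Ob D"
    and g: "g \<in> carrier (Hom D X Y)" "invariant X Y g" and f: "f \<in> carrier (Hom D Y X)"
    and gf: "Comp D Y X Y g f = Ident D Y" and fg: "Comp D X Y X f g = Ident D X"
  shows "invariant Y X f"
  unfolding invariant_def
proof
  fix h
  have hf: "Act D Y X h f \<in> carrier (Hom D Y X)"
    using obs f by (intro Act_closed)
  have "Act D Y X h f = Comp D Y X X (Comp D X Y X f g) (Act D Y X h f)"
    using obs hf by (simp add: fg Comp_Ident_left)
  also have "\<dots> = Comp D Y Y X f (Comp D Y X Y g (Act D Y X h f))"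
    using obs f g hf by (intro Comp_assoc)
  \<comment> \<open>\<open>H\<close>-linearity of post-composition with \<open>g\<close>, read from
    right to left: \<open>g (h f) = h (g f)\<close>.\<close>
  also have "Comp D Y X Y g (Act D Y X h f) = \<epsilon> h \<odot>\<^bsub>Hom D Y Y\<^esub> Ident D Y"
    using Act_Comp_invariant[OF H obs(2,1,2) f g, of h] obs by (simp add: gf Act_Ident)
  also have "Comp D Y Y X f \<dots> = \<epsilon> h \<odot>\<^bsub>Hom D Y X\<^esub> f"
    using obs f by (simp add: Comp_smult_right Ident_closed Comp_Ident_right)
  finally show "Act D Y X h f = \<epsilon> h \<odot>\<^bsub>Hom D Y X\<^esub> f" .
qed

end

theorem lemma7p2:
  fixes \<Delta> :: "'h::complex_algebra_1 \<Rightarrow> ('h, 'h) tensor"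
    and \<epsilon> :: "'h \<Rightarrow> complex"
    and S :: "'h \<Rightarrow> 'h"
    and D :: "('o, 'm, 'h) H_cat"
  assumes "hopf_algebra \<Delta> \<epsilon> S"
    and "bij S"
    and "left_H_category \<Delta> \<epsilon> D"
  shows "subgroup (UU \<epsilon> D) (GG D)"
proof -
  interpret left_H_category \<Delta> \<epsilon> D by fact
  interpret G: group "GG D" by (rule group_GG)
  have UU_iff: "\<eta> \<in> UU \<epsilon> D \<longleftrightarrow> \<eta> \<in> carrier (GG D) \<and> (\<forall>X\<in>Ob D. invariant X X (\<eta> X))" for \<eta>
    by (auto simp: UU_def invariant_def)
  \<comment> \<open>Families in the product group are extensional, so the componentwise formulas are
    claimed only at objects of \<open>D\<close>.\<close>
  have mult: "(\<eta> \<otimes>\<^bsub>GG D\<^esub> \<theta>) X = Comp D X X X (\<eta> X) (\<theta> X)" if "X \<in> Ob D" for \<eta> \<theta> X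
    using that by (simp add: GG_def Aut_group_def units_of_def End_monoid_def)
  have one: "\<one>\<^bsub>GG D\<^esub> X = Ident D X" if "X \<in> Ob D" for X
    using that by (simp add: GG_def Aut_group_def units_of_def End_monoid_def)
  have closed: "\<eta> X \<in> carrier (Hom D X X)" if "\<eta> \<in> carrier (GG D)" "X \<in> Ob D" for \<eta> X
    using that by (auto simp: GG_def Aut_group_def units_of_def End_monoid_def Units_def)
  show ?thesis
  proof (rule G.subgroupI)
    show "UU \<epsilon> D \<subseteq> carrier (GG D)"
      by (auto simp: UU_iff)
    have "\<one>\<^bsub>GG D\<^esub> \<in> UU \<epsilon> D"
      by (simp add: UU_iff one invariant_Ident)
    then show "UU \<epsilon> D \<noteq> {}" by blast
  next
    fix \<eta> assume \<eta>: "\<eta> \<in> UU \<epsilon> D"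
    then have cl: "\<eta> \<in> carrier (GG D)" "inv\<^bsub>GG D\<^esub> \<eta> \<in> carrier (GG D)"
      by (simp_all add: UU_iff)
    \<comment> \<open>Evaluating the two inverse laws of \<open>GG D\<close> at \<open>X\<close>
      shows that the component of the inverse is a two-sided inverse of
      \<open>\<eta> X\<close>.\<close>
    have "invariant X X ((inv\<^bsub>GG D\<^esub> \<eta>) X)" if X: "X \<in> Ob D" for X
    proof (rule invariant_inverse[OF assms(1) X X])
      show "Comp D X X X (\<eta> X) ((inv\<^bsub>GG D\<^esub> \<eta>) X) = Ident D X"
        using G.r_inv[OF cl(1)] mult[OF X] one[OF X] by metis
      show "Comp D X X X ((inv\<^bsub>GG D\<^esub> \<eta>) X) (\<eta> X) = Ident D X"
        using G.l_inv[OF cl(1)] mult[OF X] one[OF X] by metis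
    qed (use \<eta> cl X in \<open>simp_all add: closed UU_iff\<close>)
    then show "inv\<^bsub>GG D\<^esub> \<eta> \<in> UU \<epsilon> D"
      using cl by (simp add: UU_iff)
  next
    fix \<eta> \<theta> assume "\<eta> \<in> UU \<epsilon> D" "\<theta> \<in> UU \<epsilon> D"
    then show "\<eta> \<otimes>\<^bsub>GG D\<^esub> \<theta> \<in> UU \<epsilon> D"
      by (auto simp: UU_iff mult intro!: invariant_Comp[OF assms(1)] closed)
  qed
qed

end
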